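(* Let $(X,d_X)$ and $(Y,d_Y)$ be metric spaces and let $f:X\to Y$ be a map. Then $f:(X,d_X)\to(Y,d_Y)$ is Yoneda continuous if and only if $f:\Sigma(X,d_X)\to\Sigma(Y,d_Y)$ is a contraction of approach spaces.
   Context: A metric space is a pair $(X,d)$ with $d:X\times X\to[0,\infty]$ such that $d(x,x)=0$ and $d(x,z)\le d(x,y)+d(y,z)$ for all $x,y,z$ (no symmetry, separation or finiteness is required). A map $f:(X,d_X)\to(Y,d_Y)$ is non-expansive if $d_X(x,y)\ge d_Y(f(x),f(y))$ for all $x,y$. A net $\{x_i\}_i$ (indexed by a directed set) in $(X,d)$ is forward Cauchy if $\inf_i\sup_{k\ge j\ge i}d(x_j,x_k)=0$. An element $x\in X$ is a Yoneda limit of a forward Cauchy net $\{x_i\}_i$ if $d(x,y)=\inf_i\sup_{j\ge i}d(x_j,y)$ for all $y\in X$. A map $f:(X,d_X)\to(Y,d_Y)$ is Yoneda continuous if it is non-expansive and, whenever $x$ is a Yoneda limit of a forward Cauchy net $\{x_i\}_i$ in $X$, $f(x)$ is a Yoneda limit of $\{f(x_i)\}_i$ in $Y$. An approach space is a pair $(X,\delta)$ with $\delta:X\times 2^X\to[0,\infty]$ such that for all $x\in X$, $A,B\subseteq X$: $\delta(x,\{x\})=0$; $\delta(x,\varnothing)=\infty$; $\delta(x,A\cup B)=\min\{\delta(x,A),\delta(x,B)\}$; $\delta(x,A)\le\delta(x,B)+\sup_{b\in B}\delta(b,A)$. A contraction $f:(X,\delta_X)\to(Y,\delta_Y)$ is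 a map with $\delta_X(x,A)\ge\delta_Y(f(x),f(A))$ for all $x\in X$, $A\subseteq X$. A weight of $(X,d)$ is a function $\phi:X\to[0,\infty]$ with $\phi(x)\le\phi(y)+d(x,y)$ for all $x,y$. A weight $\phi$ is a Scott weight if for every forward Cauchy net $\{x_i\}_i$ and every Yoneda limit $x$ of it, $\inf_i\sup_{j\ge i}\phi(x_j)\ge\phi(x)$. The Scott distance of $(X,d)$ is the approach distance $\sigma(x,A)=\sup\{\phi(x)\mid\phi\text{ is a Scott weight of }(X,d)\text{ and }\phi(a)=0\text{ for all }a\in A\}$; $\Sigma(X,d)$ denotes the approach space $(X,\sigma)$. *)

theory Defs
  imports "HOL-Analysis.Analysis"
begin

text \<open>
  All structures live on explicit carrier sets, and distances take values in
  \<open>ennreal\<close>, that is in [0, \<open>\<infinity>\<close>].  The values of distances, weights and maps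
  outside the carriers are irrelevant.
\<close>

definition generalized_metric :: "'a set \<Rightarrow> ('a \<Rightarrow> 'a \<Rightarrow> ennreal) \<Rightarrow> bool" where
  "generalized_metric X d \<longleftrightarrow>
     (\<forall>x\<in>X. d x x = 0) \<and> (\<forall>x\<in>X. \<forall>y\<in>X. \<forall>z\<in>X. d x z \<le> d x y + d y z)"

definition non_expansive ::
  "'a set \<Rightarrow> ('a \<Rightarrow> 'a \<Rightarrow> ennreal) \<Rightarrow> 'b set \<Rightarrow> ('b \<Rightarrow> 'b \<Rightarrow> ennreal) \<Rightarrow> ('a \<Rightarrow> 'b) \<Rightarrow> bool" where
  "non_expansive X dX Y dY f \<longleftrightarrow>
     f \<in> X \<rightarrow> Y \<and> (\<forall>x\<in>X. \<forall>y\<in>X. dX x y \<ge> dY (f x) (f y))"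

text \<open>The pair \<open>(i, j) \<in> r\<close> is read as \<open>i \<le> j\<close>.\<close>

definition directed_set :: "'i set \<Rightarrow> 'i rel \<Rightarrow> bool" where
  "directed_set I r \<longleftrightarrow>
     preorder_on I r \<and> I \<noteq> {} \<and> (\<forall>i\<in>I. \<forall>j\<in>I. \<exists>k\<in>I. (i, k) \<in> r \<and> (j, k) \<in> r)"

definition net_limsup :: "'i set \<Rightarrow> 'i rel \<Rightarrow> ('i \<Rightarrow> ennreal) \<Rightarrow> ennreal" where
  "net_limsup I r g = (INF i\<in>I. SUP j\<in>{j\<in>I. (i, j) \<in> r}. g j)"

definition forward_Cauchy ::
  "'a set \<Rightarrow> ('a \<Rightarrow> 'a \<Rightarrow> ennreal) \<Rightarrow> 'i set \<Rightarrow> 'i rel \<Rightarrow> ('i \<Rightarrow> 'a) \<Rightarrow> bool" where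
  "forward_Cauchy X d I r s \<longleftrightarrow>
     directed_set I r \<and> s \<in> I \<rightarrow> X \<and>
     (INF i\<in>I. SUP (j, k)\<in>{(j, k). j \<in> I \<and> k \<in> I \<and> (i, j) \<in> r \<and> (j, k) \<in> r}. d (s j) (s k)) = 0"

definition Yoneda_limit ::
  "'a set \<Rightarrow> ('a \<Rightarrow> 'a \<Rightarrow> ennreal) \<Rightarrow> 'i set \<Rightarrow> 'i rel \<Rightarrow> ('i \<Rightarrow> 'a) \<Rightarrow> 'a \<Rightarrow> bool" where
  "Yoneda_limit X d I r s x \<longleftrightarrow>
     forward_Cauchy X d I r s \<and> x \<in> X \<and> (\<forall>y\<in>X. d x y = net_limsup I r (\<lambda>j. d (s j) y))"

text \<open>
  HOL cannot quantify over all index types inside a definition.  For a space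
  carried by a subset of the type \<open>'a\<close>, nets are indexed by arbitrary directed
  (pre)orders on arbitrary subsets of the following type.  This type is large enough: the
  theorems \<open>Scott_weight_any_index\<close> and \<open>Yoneda_continuous_any_index\<close> below
  show that the defining conditions then hold for nets over directed sets of
  every type.
\<close>

type_synonym 'a net_index = "('a \<times> nat) set"

definition Yoneda_continuous ::
  "'a set \<Rightarrow> ('a \<Rightarrow> 'a \<Rightarrow> ennreal) \<Rightarrow> 'b set \<Rightarrow> ('b \<Rightarrow> 'b \<Rightarrow> ennreal) \<Rightarrow> ('a \<Rightarrow> 'b) \<Rightarrow> bool" where
  "Yoneda_continuous X dX Y dY f \<longleftrightarrow>
     non_expansive X dX Y dY f \<and>
     (\<forall>(I :: 'a net_index set) r s x.
        Yoneda_limit X dX I r s x \<longrightarrow> Yoneda_limit Y dY I r (f \<circ> s) (f x))"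

definition approach_space :: "'a set \<Rightarrow> ('a \<Rightarrow> 'a set \<Rightarrow> ennreal) \<Rightarrow> bool" where
  "approach_space X \<delta> \<longleftrightarrow>
     (\<forall>x\<in>X. \<delta> x {x} = 0) \<and>
     (\<forall>x\<in>X. \<delta> x {} = \<infinity>) \<and>
     (\<forall>x\<in>X. \<forall>A B. A \<subseteq> X \<and> B \<subseteq> X \<longrightarrow> \<delta> x (A \<union> B) = min (\<delta> x A) (\<delta> x B)) \<and>
     (\<forall>x\<in>X. \<forall>A B. A \<subseteq> X \<and> B \<subseteq> X \<longrightarrow> \<delta> x A \<le> \<delta> x B + (SUP b\<in>B. \<delta> b A))"

definition approach_contraction ::
  "'a set \<Rightarrow> ('a \<Rightarrow> 'a set \<Rightarrow> ennreal) \<Rightarrow> 'b set \<Rightarrow> ('b \<Rightarrow> 'b set \<Rightarrow> ennreal) \<Rightarrow> ('a \<Rightarrow> 'b) \<Rightarrow> bool" where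
  "approach_contraction X \<delta>X Y \<delta>Y f \<longleftrightarrow>
     approach_space X \<delta>X \<and> approach_space Y \<delta>Y \<and> f \<in> X \<rightarrow> Y \<and>
     (\<forall>x\<in>X. \<forall>A. A \<subseteq> X \<longrightarrow> \<delta>X x A \<ge> \<delta>Y (f x) (f ` A))"

definition weight :: "'a set \<Rightarrow> ('a \<Rightarrow> 'a \<Rightarrow> ennreal) \<Rightarrow> ('a \<Rightarrow> ennreal) \<Rightarrow> bool" where
  "weight X d \<phi> \<longleftrightarrow> (\<forall>x\<in>X. \<forall>y\<in>X. \<phi> x \<le> \<phi> y + d x y)"

definition Scott_weight :: "'a set \<Rightarrow> ('a \<Rightarrow> 'a \<Rightarrow> ennreal) \<Rightarrow> ('a \<Rightarrow> ennreal) \<Rightarrow> bool" where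
  "Scott_weight X d \<phi> \<longleftrightarrow>
     weight X d \<phi> \<and>
     (\<forall>(I :: 'a net_index set) r s x.
        Yoneda_limit X d I r s x \<longrightarrow> net_limsup I r (\<lambda>j. \<phi> (s j)) \<ge> \<phi> x)"

definition Scott_distance :: "'a set \<Rightarrow> ('a \<Rightarrow> 'a \<Rightarrow> ennreal) \<Rightarrow> 'a \<Rightarrow> 'a set \<Rightarrow> ennreal" where
  "Scott_distance X d x A = (SUP \<phi>\<in>{\<phi>. Scott_weight X d \<phi> \<and> (\<forall>a\<in>A. \<phi> a = 0)}. \<phi> x)"

text \<open>
  From here on: proofs that the index type is adequate and that the Scott
  distance is an approach distance.  The filter \<open>tails\<close> is used only there.
\<close>

definition tails :: "'i set \<Rightarrow> 'i rel \<Rightarrow> 'i filter" where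
  "tails I r = (INF i\<in>I. principal {j\<in>I. (i, j) \<in> r})"

lemma eventually_tails:
  assumes "directed_set I r"
  shows "eventually P (tails I r) \<longleftrightarrow> (\<exists>i\<in>I. \<forall>j\<in>I. (i, j) \<in> r \<longrightarrow> P j)"
proof -
  have tr: "trans r" and ne: "I \<noteq> {}"
    using assms by (auto simp: directed_set_def preorder_on_def)
  have "eventually P (tails I r) \<longleftrightarrow> (\<exists>i\<in>I. eventually P (principal {j\<in>I. (i, j) \<in> r}))"
    unfolding tails_def
  proof (rule eventually_INF_base[OF ne])
    fix a b assume "a \<in> I" "b \<in> I"
    then obtain k where "k \<in> I" "(a, k) \<in> r" "(b, k) \<in> r"
      using assms unfolding directed_set_def by blast
    then show "\<exists>x\<in>I. principal {j \<in> I. (x, j) \<in> r} \<le>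
        inf (principal {j \<in> I. (a, j) \<in> r}) (principal {j \<in> I. (b, j) \<in> r})"
      using tr by (intro bexI[of _ k]) (auto dest: transD)
  qed
  then show ?thesis by (auto simp: eventually_principal)
qed

lemma tails_neq_bot:
  assumes "directed_set I r"
  shows "tails I r \<noteq> bot"
proof
  assume "tails I r = bot"
  then have "eventually (\<lambda>_. False) (tails I r)" by simp
  then show False
    using assms unfolding eventually_tails[OF assms] directed_set_def by blast
qed

lemma net_limsup_eq_Limsup:
  assumes dir: "directed_set I r"
  shows "net_limsup I r g = Limsup (tails I r) g"
proof (rule antisym)
  show "net_limsup I r g \<le> Limsup (tails I r) g"
    unfolding Limsup_def
  proof (rule INF_greatest)
    fix P assume "P \<in> {P. eventually P (tails I r)}"
    then obtain i where "i \<in> I" "\<forall>j\<in>I. (i, j) \<in> r \<longrightarrow> P j"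
      using eventually_tails[OF dir] by auto
    then show "net_limsup I r g \<le> (SUP x\<in>{x. P x}. g x)"
      unfolding net_limsup_def by (intro INF_lower2[of i] SUP_subset_mono) auto
  qed
next
  show "Limsup (tails I r) g \<le> net_limsup I r g"
    unfolding net_limsup_def
  proof (rule INF_greatest)
    fix i assume "i \<in> I"
    then have "eventually (\<lambda>j. j \<in> I \<and> (i, j) \<in> r) (tails I r)"
      using eventually_tails[OF dir] by auto
    then show "Limsup (tails I r) g \<le> (SUP j\<in>{j \<in> I. (i, j) \<in> r}. g j)"
      unfolding Limsup_def by (intro INF_lower2[of "\<lambda>j. j \<in> I \<and> (i, j) \<in> r"]) auto
  qed
qed

lemma net_limsup_eqI:
  assumes "directed_set I r" "(g \<longlongrightarrow> L) (tails I r)"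
  shows "net_limsup I r g = L"
  using assms by (simp add: net_limsup_eq_Limsup lim_imp_Limsup tails_neq_bot)

lemma forward_CauchyD:
  assumes "forward_Cauchy X d I r s" "e > 0"
  shows "\<exists>i\<in>I. \<forall>j\<in>I. \<forall>k\<in>I. (i, j) \<in> r \<longrightarrow> (j, k) \<in> r \<longrightarrow> d (s j) (s k) \<le> e"
proof -
  have "(INF i\<in>I. SUP (j, k)\<in>{(j, k). j \<in> I \<and> k \<in> I \<and> (i, j) \<in> r \<and> (j, k) \<in> r}. d (s j) (s k)) < e"
    using assms by (simp add: forward_Cauchy_def)
  then obtain i where i: "i \<in> I"
    "(SUP (j, k)\<in>{(j, k). j \<in> I \<and> k \<in> I \<and> (i, j) \<in> r \<and> (j, k) \<in> r}. d (s j) (s k)) < e"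
    unfolding INF_less_iff by blast
  have "d (s j) (s k) \<le> e" if "j \<in> I" "k \<in> I" "(i, j) \<in> r" "(j, k) \<in> r" for j k
  proof -
    have "d (s j) (s k) \<le>
      (SUP (j, k)\<in>{(j, k). j \<in> I \<and> k \<in> I \<and> (i, j) \<in> r \<and> (j, k) \<in> r}. d (s j) (s k))"
      using that by (intro SUP_upper2[of "(j, k)"]) auto
    then show ?thesis using i(2) by simp
  qed
  with i(1) show ?thesis by blast
qed

lemma forward_CauchyI:
  assumes "directed_set I r" "s \<in> I \<rightarrow> X"
    and *: "\<And>e::real. e > 0 \<Longrightarrow>
      \<exists>i\<in>I. \<forall>j\<in>I. \<forall>k\<in>I. (i, j) \<in> r \<longrightarrow> (j, k) \<in> r \<longrightarrow> d (s j) (s k) \<le> ennreal e"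
  shows "forward_Cauchy X d I r s"
proof -
  let ?S = "INF i\<in>I. SUP (j, k)\<in>{(j, k). j \<in> I \<and> k \<in> I \<and> (i, j) \<in> r \<and> (j, k) \<in> r}. d (s j) (s k)"
  have "?S \<le> 0"
  proof (rule ennreal_le_epsilon)
    fix e :: real assume "0 < e"
    from *[OF this] obtain i where i: "i \<in> I"
      "\<forall>j\<in>I. \<forall>k\<in>I. (i, j) \<in> r \<longrightarrow> (j, k) \<in> r \<longrightarrow> d (s j) (s k) \<le> ennreal e"
      by blast
    then show "?S \<le> 0 + ennreal e"
      by (intro INF_lower2[of i] SUP_least) auto
  qed
  with assms(1,2) show ?thesis by (simp add: forward_Cauchy_def)
qed

lemma weight_tendsto_net_limsup:
  assumes fC: "forward_Cauchy X d I r s" and w: "weight X d h"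
  shows "((\<lambda>j. h (s j)) \<longlongrightarrow> net_limsup I r (\<lambda>j. h (s j))) (tails I r)"
proof -
  have dir: "directed_set I r" and sX: "s \<in> I \<rightarrow> X"
    using fC by (auto simp: forward_Cauchy_def)
  let ?L = "Limsup (tails I r) (\<lambda>j. h (s j))" and ?l = "Liminf (tails I r) (\<lambda>j. h (s j))"
  have "?L \<le> ?l"
  proof (rule ennreal_le_epsilon)
    fix e :: real assume "0 < e"
    then obtain i where i: "i \<in> I"
      "\<And>j k. \<lbrakk>j \<in> I; k \<in> I; (i, j) \<in> r; (j, k) \<in> r\<rbrakk> \<Longrightarrow> d (s j) (s k) \<le> ennreal e"
      using forward_CauchyD[OF fC, of "ennreal e"] by auto
    have "h (s j) \<le> ?l + ennreal e" if j: "j \<in> I" "(i, j) \<in> r" for j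
    proof -
      have "h (s j) - ennreal e \<le> h (s k)" if k: "k \<in> I" "(j, k) \<in> r" for k
      proof -
        have "h (s j) \<le> h (s k) + d (s j) (s k)"
          using w sX j k by (auto simp: weight_def)
        also have "\<dots> \<le> h (s k) + ennreal e"
          using i(2) j k by (intro add_left_mono) auto
        finally show ?thesis
          by (simp add: ennreal_minus_le_iff add.commute)
      qed
      then have "h (s j) - ennreal e \<le> ?l"
        using j by (intro Liminf_bounded) (auto simp: eventually_tails[OF dir])
      then show ?thesis
        by (simp add: ennreal_minus_le_iff add.commute)
    qed
    then show "?L \<le> ?l + ennreal e"
      using i(1) by (intro Limsup_bounded) (auto simp: eventually_tails[OF dir])
  qed
  moreover have "?l \<le> ?L"
    by (intro Liminf_le_Limsup tails_neq_bot dir)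
  ultimately show ?thesis
    using tails_neq_bot[OF dir]
    by (simp add: net_limsup_eq_Limsup[OF dir] tendsto_iff_Liminf_eq_Limsup)
qed

lemma directed_set_finite_bound:
  assumes dir: "directed_set I r" and "finite S" "S \<subseteq> I"
  shows "\<exists>u\<in>I. \<forall>v\<in>S. (v, u) \<in> r"
  using assms(2,3)
proof (induction S)
  case empty
  then show ?case using dir by (auto simp: directed_set_def)
next
  case (insert a S)
  then obtain u where u: "u \<in> I" "\<forall>v\<in>S. (v, u) \<in> r" by auto
  have "a \<in> I" using insert.prems by simp
  with u(1) obtain w where w: "w \<in> I" "(a, w) \<in> r" "(u, w) \<in> r"
    using dir unfolding directed_set_def by blast
  have "trans r" using dir by (auto simp: directed_set_def preorder_on_def)
  with u w have "\<forall>v\<in>insert a S. (v, w) \<in> r" by (auto dest: transD)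
  with w(1) show ?case by blast
qed

lemma monotone_finite_choice:
  assumes dir: "directed_set I r" and c: "\<And>t. c t \<in> I"
  obtains m where "\<And>F. finite F \<Longrightarrow> m F \<in> I"
    "\<And>F t. \<lbrakk>finite F; t \<in> F\<rbrakk> \<Longrightarrow> (c t, m F) \<in> r"
    "\<And>F G. \<lbrakk>finite F; G \<subseteq> F\<rbrakk> \<Longrightarrow> (m G, m F) \<in> r"
proof -
  define P where "P f F u \<longleftrightarrow> (finite F \<longrightarrow> u \<in> I \<and> (\<forall>t\<in>F. (c t, u) \<in> r) \<and>
      (\<forall>G. G \<subset> F \<longrightarrow> (f G, u) \<in> r))" for f F u
  have "\<exists>m. \<forall>F. P m F (m F)"
  proof (rule dependent_wf_choice[OF wf_finite_psubset])
    fix f g :: "'b set \<Rightarrow> 'a" and F u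
    assume "\<And>G. (G, F) \<in> finite_psubset \<Longrightarrow> f G = g G"
    then show "P f F u = P g F u" by (auto simp: P_def finite_psubset_def)
  next
    fix F and f :: "'b set \<Rightarrow> 'a"
    assume IH: "\<And>G. (G, F) \<in> finite_psubset \<Longrightarrow> P f G (f G)"
    show "\<exists>u. P f F u"
    proof (cases "finite F")
      case True
      let ?S = "c ` F \<union> f ` {G. G \<subset> F}"
      have "{G. G \<subset> F} \<subseteq> Pow F" by auto
      then have "finite ?S" using True by (auto intro: finite_subset)
      moreover have "?S \<subseteq> I"
      proof -
        have "f G \<in> I" if "G \<subset> F" for G
        proof -
          have "finite G" using True that by (rule finite_subset[OF psubset_imp_subset, rotated])
          moreover have "P f G (f G)" using IH[of G] that True by (simp add: finite_psubset_def)
          ultimately show ?thesis by (simp add: P_def)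
        qed
        then show ?thesis using c by auto
      qed
      ultimately have "\<exists>u\<in>I. \<forall>v\<in>?S. (v, u) \<in> r"
        by (rule directed_set_finite_bound[OF dir])
      then obtain u where "u \<in> I" "\<forall>v\<in>?S. (v, u) \<in> r" ..
      then have "P f F u" by (simp add: P_def)
      then show ?thesis ..
    qed (auto simp: P_def)
  qed
  then obtain m where m: "\<And>F. P m F (m F)" by blast
  show thesis
  proof (rule that[of m])
    fix F G :: "'b set" assume F: "finite F" and G: "G \<subseteq> F"
    show "(m G, m F) \<in> r"
    proof (cases "G = F")
      case True
      have "m F \<in> I" using m[of F] F by (simp add: P_def)
      then show ?thesis
        using True dir by (auto simp: directed_set_def preorder_on_def refl_on_def)
    next
      case False
      then show ?thesis using m[of F] F G by (auto simp: P_def)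
    qed
  qed (use m in \<open>auto simp: P_def\<close>)
qed

lemma reindex_net:
  fixes X :: "'a set" and I :: "'i set"
  assumes gm: "generalized_metric X d" and lim: "Yoneda_limit X d I r s x"
    and w: "weight X d h"
  obtains J :: "'a net_index set" and q m where
    "Yoneda_limit X d J q (s \<circ> m) x"
    "net_limsup J q (\<lambda>j. h (s (m j))) = net_limsup I r (\<lambda>j. h (s j))"
proof -
  have fC: "forward_Cauchy X d I r s" and xX: "x \<in> X"
    and xlim: "\<And>y. y \<in> X \<Longrightarrow> d x y = net_limsup I r (\<lambda>j. d (s j) y)"
    using lim by (auto simp: Yoneda_limit_def)
  have dir: "directed_set I r" and sX: "s \<in> I \<rightarrow> X"
    using fC by (auto simp: forward_Cauchy_def)
  have wd: "weight X d (\<lambda>z. d z y)" if "y \<in> X" for y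
    using gm that by (auto simp: weight_def generalized_metric_def add.commute)
  have basis: "\<exists>A::nat \<Rightarrow> ennreal set. (\<forall>n. open (A n) \<and> L \<in> A n) \<and>
      (\<forall>S. open S \<longrightarrow> L \<in> S \<longrightarrow> (\<exists>n. A n \<subseteq> S))" for L
  proof -
    obtain A :: "nat \<Rightarrow> ennreal set" where "\<And>n. open (A n)" "\<And>n. L \<in> A n"
      "\<And>S. open S \<Longrightarrow> L \<in> S \<Longrightarrow> eventually (\<lambda>i. A i \<subseteq> S) sequentially"
      using countable_basis_at_decseq[of L] by metis
    then show ?thesis
      by (intro exI[of _ A]) (meson eventually_happens trivial_limit_sequentially)
  qed
  then obtain A :: "ennreal \<Rightarrow> nat \<Rightarrow> ennreal set" where
    A: "\<And>L n. open (A L n)" "\<And>L n. L \<in> A L n"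
      "\<And>L S. open S \<Longrightarrow> L \<in> S \<Longrightarrow> \<exists>n. A L n \<subseteq> S"
    by metis
  define Lh where "Lh = net_limsup I r (\<lambda>j. h (s j))"
  define good where "good y n i \<longleftrightarrow>
      (\<forall>j\<in>I. (i, j) \<in> r \<longrightarrow> (y \<in> X \<longrightarrow> d (s j) y \<in> A (d x y) n) \<and> h (s j) \<in> A Lh n) \<and>
      (\<forall>j\<in>I. \<forall>k\<in>I. (i, j) \<in> r \<longrightarrow> (j, k) \<in> r \<longrightarrow> d (s j) (s k) \<le> ennreal (1 / real (Suc n)))" for y n i
  have "\<exists>i\<in>I. good y n i" for y n
  proof -
    have "eventually (\<lambda>j. d (s j) y \<in> A (d x y) n) (tails I r)" if "y \<in> X"
      using weight_tendsto_net_limsup[OF fC wd[OF that]] A(1,2) xlim[OF that]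
      by (auto simp: tendsto_def)
    then have "eventually (\<lambda>j. y \<in> X \<longrightarrow> d (s j) y \<in> A (d x y) n) (tails I r)"
      by (cases "y \<in> X") auto
    moreover have "eventually (\<lambda>j. h (s j) \<in> A Lh n) (tails I r)"
      using weight_tendsto_net_limsup[OF fC w] A(1,2) by (auto simp: tendsto_def Lh_def)
    ultimately have "eventually (\<lambda>j. (y \<in> X \<longrightarrow> d (s j) y \<in> A (d x y) n) \<and> h (s j) \<in> A Lh n) (tails I r)"
      by (rule eventually_conj)
    then obtain i1 where i1: "i1 \<in> I" "\<forall>j\<in>I. (i1, j) \<in> r \<longrightarrow>
        (y \<in> X \<longrightarrow> d (s j) y \<in> A (d x y) n) \<and> h (s j) \<in> A Lh n"
      unfolding eventually_tails[OF dir] by blast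
    have "ennreal (1 / real (Suc n)) > 0" by simp
    from forward_CauchyD[OF fC this] obtain i2 where i2: "i2 \<in> I"
      "\<forall>j\<in>I. \<forall>k\<in>I. (i2, j) \<in> r \<longrightarrow> (j, k) \<in> r \<longrightarrow> d (s j) (s k) \<le> ennreal (1 / real (Suc n))"
      by blast
    obtain i where i: "i \<in> I" "(i1, i) \<in> r" "(i2, i) \<in> r"
      using dir i1(1) i2(1) unfolding directed_set_def by blast
    have tr: "trans r" using dir by (auto simp: directed_set_def preorder_on_def)
    have "good y n i"
      unfolding good_def using i i1 i2 transD[OF tr] by meson
    with i(1) show ?thesis by blast
  qed
  then obtain c' where c': "\<And>y n. c' y n \<in> I \<and> good y n (c' y n)" by metis
  define c where "c t = c' (fst t) (snd t)" for t
  have cI: "c t \<in> I" and cgood: "good (fst t) (snd t) (c t)" for t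
    using c' by (auto simp: c_def)
  obtain m where m: "\<And>F. finite F \<Longrightarrow> m F \<in> I"
    "\<And>F t. \<lbrakk>finite F; t \<in> F\<rbrakk> \<Longrightarrow> (c t, m F) \<in> r"
    "\<And>F G. \<lbrakk>finite F; G \<subseteq> F\<rbrakk> \<Longrightarrow> (m G, m F) \<in> r"
    using monotone_finite_choice[of I r c, OF dir cI] by blast
  define J :: "'a net_index set" where "J = {F. finite F}"
  define q :: "'a net_index rel" where "q = {(F, G). finite F \<and> finite G \<and> F \<subseteq> G}"
  have dirJ: "directed_set J q"
    unfolding directed_set_def
  proof (intro conjI ballI)
    show "preorder_on J q"
      by (auto simp: preorder_on_def J_def q_def refl_on_def trans_def)
    show "J \<noteq> {}" by (auto simp: J_def)
    fix F G assume "F \<in> J" "G \<in> J"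
    then show "\<exists>k\<in>J. (F, k) \<in> q \<and> (G, k) \<in> q"
      by (intro bexI[of _ "F \<union> G"]) (auto simp: J_def q_def)
  qed
  have ind: "good y n (c (y, n))" for y n
    using cgood[of "(y, n)"] by simp
  have limd: "((\<lambda>j. d (s (m j)) y) \<longlongrightarrow> d x y) (tails J q)" if y: "y \<in> X" for y
  proof (rule topological_tendstoI)
    fix S assume "open S" "d x y \<in> S"
    then obtain n where n: "A (d x y) n \<subseteq> S" using A(3) by blast
    have "d (s (m G)) y \<in> S" if "G \<in> J" "({(y, n)}, G) \<in> q" for G
      using ind[of y n] m(1)[of G] m(2)[of G "(y, n)"] that y n
      by (auto simp: good_def J_def q_def)
    then show "eventually (\<lambda>j. d (s (m j)) y \<in> S) (tails J q)"
      unfolding eventually_tails[OF dirJ] by (intro bexI[of _ "{(y, n)}"]) (auto simp: J_def)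
  qed
  have limh: "((\<lambda>j. h (s (m j))) \<longlongrightarrow> Lh) (tails J q)"
  proof (rule topological_tendstoI)
    fix S assume "open S" "Lh \<in> S"
    then obtain n where n: "A Lh n \<subseteq> S" using A(3) by blast
    have "h (s (m G)) \<in> S" if "G \<in> J" "({(x, n)}, G) \<in> q" for G
      using ind[of x n] m(1)[of G] m(2)[of G "(x, n)"] that n
      by (auto simp: good_def J_def q_def)
    then show "eventually (\<lambda>j. h (s (m j)) \<in> S) (tails J q)"
      unfolding eventually_tails[OF dirJ] by (intro bexI[of _ "{(x, n)}"]) (auto simp: J_def)
  qed
  have "forward_Cauchy X d J q (s \<circ> m)"
  proof (rule forward_CauchyI[OF dirJ])
    show "s \<circ> m \<in> J \<rightarrow> X" using sX m(1) by (auto simp: J_def)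
    fix e :: real assume "e > 0"
    then obtain n where n: "1 / real (Suc n) < e" by (rule nat_approx_posE)
    have "d ((s \<circ> m) F) ((s \<circ> m) G) \<le> ennreal e"
      if "F \<in> J" "G \<in> J" "({(x, n)}, F) \<in> q" "(F, G) \<in> q" for F G
    proof -
      have "d (s (m F)) (s (m G)) \<le> ennreal (1 / real (Suc n))"
        using ind[of x n] m(1)[of F] m(1)[of G] m(2)[of F "(x, n)"] m(3)[of G F] that
        by (auto simp: good_def J_def q_def)
      also have "\<dots> \<le> ennreal e" using n by (intro ennreal_leI) simp
      finally show ?thesis by simp
    qed
    then show "\<exists>i\<in>J. \<forall>j\<in>J. \<forall>k\<in>J. (i, j) \<in> q \<longrightarrow> (j, k) \<in> q \<longrightarrow>
        d ((s \<circ> m) j) ((s \<circ> m) k) \<le> ennreal e"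
      by (intro bexI[of _ "{(x, n)}"]) (auto simp: J_def)
  qed
  moreover have "d x y = net_limsup J q (\<lambda>j. d ((s \<circ> m) j) y)" if "y \<in> X" for y
    using net_limsup_eqI[OF dirJ limd[OF that]] by simp
  ultimately have "Yoneda_limit X d J q (s \<circ> m) x"
    using xX by (simp add: Yoneda_limit_def)
  moreover have "net_limsup J q (\<lambda>j. h (s (m j))) = Lh"
    by (rule net_limsup_eqI[OF dirJ limh])
  ultimately show thesis
    using that unfolding Lh_def by blast
qed

theorem Scott_weight_any_index:
  fixes I :: "'i set"
  assumes "generalized_metric X d" "Scott_weight X d \<phi>" "Yoneda_limit X d I r s x"
  shows "net_limsup I r (\<lambda>j. \<phi> (s j)) \<ge> \<phi> x"
proof -
  have "weight X d \<phi>" using assms(2) by (simp add: Scott_weight_def)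
  from reindex_net[OF assms(1,3) this] obtain J :: "'a net_index set" and q m where *:
    "Yoneda_limit X d J q (s \<circ> m) x"
    "net_limsup J q (\<lambda>j. \<phi> (s (m j))) = net_limsup I r (\<lambda>j. \<phi> (s j))" .
  have "\<phi> x \<le> net_limsup J q (\<lambda>j. \<phi> ((s \<circ> m) j))"
    using assms(2) *(1) unfolding Scott_weight_def by blast
  with *(2) show ?thesis by simp
qed

theorem Yoneda_continuous_any_index:
  fixes I :: "'i set"
  assumes gX: "generalized_metric X dX" and gY: "generalized_metric Y dY"
    and f: "Yoneda_continuous X dX Y dY f" and lim: "Yoneda_limit X dX I r s x"
  shows "Yoneda_limit Y dY I r (f \<circ> s) (f x)"
proof -
  have fXY: "f \<in> X \<rightarrow> Y" and ne: "\<And>x y. \<lbrakk>x \<in> X; y \<in> X\<rbrakk> \<Longrightarrow> dY (f x) (f y) \<le> dX x y"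
    using f by (auto simp: Yoneda_continuous_def non_expansive_def)
  have fC: "forward_Cauchy X dX I r s" and xX: "x \<in> X"
    using lim by (auto simp: Yoneda_limit_def)
  have dir: "directed_set I r" and sX: "s \<in> I \<rightarrow> X"
    using fC by (auto simp: forward_Cauchy_def)
  have "forward_Cauchy Y dY I r (f \<circ> s)"
  proof (rule forward_CauchyI[OF dir])
    show "f \<circ> s \<in> I \<rightarrow> Y" using fXY sX by auto
    fix e :: real assume "e > 0"
    then obtain i where i: "i \<in> I"
      "\<forall>j\<in>I. \<forall>k\<in>I. (i, j) \<in> r \<longrightarrow> (j, k) \<in> r \<longrightarrow> dX (s j) (s k) \<le> ennreal e"
      using forward_CauchyD[OF fC, of "ennreal e"] by auto
    then show "\<exists>i\<in>I. \<forall>j\<in>I. \<forall>k\<in>I. (i, j) \<in> r \<longrightarrow> (j, k) \<in> r \<longrightarrow>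
        dY ((f \<circ> s) j) ((f \<circ> s) k) \<le> ennreal e"
      using sX by (intro bexI[of _ i]) (auto intro: order_trans[OF ne])
  qed
  moreover have "dY (f x) y = net_limsup I r (\<lambda>j. dY (f (s j)) y)" if y: "y \<in> Y" for y
  proof -
    have "weight X dX (\<lambda>z. dY (f z) y)"
      unfolding weight_def
    proof (intro ballI)
      fix a b assume ab: "a \<in> X" "b \<in> X"
      have "dY (f a) y \<le> dY (f a) (f b) + dY (f b) y"
        using gY fXY ab y unfolding generalized_metric_def by blast
      also have "\<dots> \<le> dX a b + dY (f b) y" using ne ab by (intro add_right_mono) auto
      finally show "dY (f a) y \<le> dY (f b) y + dX a b" by (simp add: add.commute)
    qed
    from reindex_net[OF gX lim this] obtain J :: "'a net_index set" and q m where *: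
      "Yoneda_limit X dX J q (s \<circ> m) x"
      "net_limsup J q (\<lambda>j. dY (f (s (m j))) y) = net_limsup I r (\<lambda>j. dY (f (s j)) y)" .
    have "Yoneda_limit Y dY J q (f \<circ> (s \<circ> m)) (f x)"
      using f *(1) unfolding Yoneda_continuous_def by blast
    then have "dY (f x) y = net_limsup J q (\<lambda>j. dY (f (s (m j))) y)"
      using y by (simp add: Yoneda_limit_def)
    with *(2) show ?thesis by simp
  qed
  ultimately show ?thesis
    using fXY xX by (auto simp: Yoneda_limit_def)
qed

lemma Scott_weight_const: "Scott_weight X d (\<lambda>_. c)"
proof -
  have "c \<le> net_limsup I r (\<lambda>_. c)" if "Yoneda_limit X d I r s x"
    for I :: "'a net_index set" and r s x
  proof -
    have dir: "directed_set I r"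
      using that by (auto simp: Yoneda_limit_def forward_Cauchy_def)
    show ?thesis using net_limsup_eqI[OF dir tendsto_const] by simp
  qed
  then show ?thesis by (auto simp: Scott_weight_def weight_def)
qed

lemma Scott_weight_min:
  assumes "Scott_weight X d \<phi>" "Scott_weight X d \<psi>"
  shows "Scott_weight X d (\<lambda>z. min (\<phi> z) (\<psi> z))"
proof -
  have w: "weight X d \<phi>" "weight X d \<psi>" using assms by (auto simp: Scott_weight_def)
  have "weight X d (\<lambda>z. min (\<phi> z) (\<psi> z))"
    unfolding weight_def
  proof (intro ballI)
    fix a b assume "a \<in> X" "b \<in> X"
    then have "\<phi> a \<le> \<phi> b + d a b" "\<psi> a \<le> \<psi> b + d a b" using w by (auto simp: weight_def)
    then show "min (\<phi> a) (\<psi> a) \<le> min (\<phi> b) (\<psi> b) + d a b"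
      unfolding min_def[of "\<phi> b"] by (simp add: min.coboundedI1 min.coboundedI2)
  qed
  moreover have "min (\<phi> x) (\<psi> x) \<le> net_limsup I r (\<lambda>j. min (\<phi> (s j)) (\<psi> (s j)))"
    if lim: "Yoneda_limit X d I r s x" for I :: "'a net_index set" and r s x
  proof -
    have fC: "forward_Cauchy X d I r s" and dir: "directed_set I r"
      using lim by (auto simp: Yoneda_limit_def forward_Cauchy_def)
    have "net_limsup I r (\<lambda>j. min (\<phi> (s j)) (\<psi> (s j))) =
        min (net_limsup I r (\<lambda>j. \<phi> (s j))) (net_limsup I r (\<lambda>j. \<psi> (s j)))"
      by (intro net_limsup_eqI[OF dir] tendsto_min weight_tendsto_net_limsup[OF fC] w)
    moreover have "\<phi> x \<le> net_limsup I r (\<lambda>j. \<phi> (s j))" "\<psi> x \<le> net_limsup I r (\<lambda>j. \<psi> (s j))"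
      using assms lim unfolding Scott_weight_def by blast+
    ultimately show ?thesis by (simp add: min.coboundedI1 min.coboundedI2)
  qed
  ultimately show ?thesis unfolding Scott_weight_def by blast
qed

lemma Scott_weight_diff:
  assumes "Scott_weight X d \<phi>"
    and "c \<noteq> top"
  shows "Scott_weight X d (\<lambda>z. \<phi> z - c)"
proof -
  have le: "a - c \<le> b \<longleftrightarrow> a \<le> b + c" for a b
    using assms(2) by (simp add: ennreal_minus_le_iff add.commute)
  have sub: "a \<le> (a - c) + c" for a using le[of a "a - c"] by simp
  have w: "weight X d \<phi>" using assms by (auto simp: Scott_weight_def)
  have w': "weight X d (\<lambda>z. \<phi> z - c)"
    unfolding weight_def le
  proof (intro ballI)
    fix a b assume "a \<in> X" "b \<in> X"
    then have "\<phi> a \<le> \<phi> b + d a b" using w by (auto simp: weight_def)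
    also have "\<dots> \<le> (\<phi> b - c) + c + d a b" by (intro add_right_mono sub)
    finally show "\<phi> a \<le> (\<phi> b - c) + d a b + c" by (simp add: ac_simps)
  qed
  moreover have "\<phi> x - c \<le> net_limsup I r (\<lambda>j. \<phi> (s j) - c)"
    if lim: "Yoneda_limit X d I r s x" for I :: "'a net_index set" and r s x
  proof -
    have fC: "forward_Cauchy X d I r s" and dir: "directed_set I r"
      using lim by (auto simp: Yoneda_limit_def forward_Cauchy_def)
    have "\<phi> x \<le> net_limsup I r (\<lambda>j. \<phi> (s j))"
      using assms lim unfolding Scott_weight_def by blast
    also have "\<dots> \<le> net_limsup I r (\<lambda>j. (\<phi> (s j) - c) + c)"
      unfolding net_limsup_def by (intro INF_superset_mono SUP_subset_mono sub) auto
    also have "\<dots> = net_limsup I r (\<lambda>j. \<phi> (s j) - c) + c"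
      by (intro net_limsup_eqI[OF dir] tendsto_add tendsto_const weight_tendsto_net_limsup[OF fC w'])
    finally show ?thesis by (simp add: le)
  qed
  ultimately show ?thesis unfolding Scott_weight_def by blast
qed

lemma Scott_distance_upper:
  assumes "Scott_weight X d \<phi>" "\<And>a. a \<in> A \<Longrightarrow> \<phi> a = 0"
  shows "\<phi> x \<le> Scott_distance X d x A"
  unfolding Scott_distance_def using assms by (intro SUP_upper) auto

theorem approach_space_Scott_distance: "approach_space X (Scott_distance X d)"
  unfolding approach_space_def
proof (intro conjI ballI allI impI)
  fix x
  show "Scott_distance X d x {x} = 0"
  proof (rule antisym)
    show "Scott_distance X d x {x} \<le> 0"
      unfolding Scott_distance_def by (rule SUP_least) simp
  qed simp
  show "Scott_distance X d x {} = \<infinity>"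
    using Scott_distance_upper[OF Scott_weight_const[of X d \<infinity>], of "{}" x]
    by (simp add: top_unique)
next
  fix x A B
  show "Scott_distance X d x (A \<union> B) = min (Scott_distance X d x A) (Scott_distance X d x B)"
  proof (rule antisym)
    show "Scott_distance X d x (A \<union> B) \<le> min (Scott_distance X d x A) (Scott_distance X d x B)"
      unfolding Scott_distance_def by (intro min.boundedI SUP_subset_mono) auto
    show "min (Scott_distance X d x A) (Scott_distance X d x B) \<le> Scott_distance X d x (A \<union> B)"
    proof (rule dense_le)
      fix u assume "u < min (Scott_distance X d x A) (Scott_distance X d x B)"
      then obtain \<phi> \<psi> where *: "Scott_weight X d \<phi>" "\<forall>a\<in>A. \<phi> a = 0" "u < \<phi> x"
        "Scott_weight X d \<psi>" "\<forall>a\<in>B. \<psi> a = 0" "u < \<psi> x"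
        by (auto simp: Scott_distance_def less_SUP_iff)
      then have "min (\<phi> x) (\<psi> x) \<le> Scott_distance X d x (A \<union> B)"
        by (intro Scott_distance_upper[of X d "\<lambda>z. min (\<phi> z) (\<psi> z)"] Scott_weight_min)
          (auto simp: min_def)
      then show "u \<le> Scott_distance X d x (A \<union> B)"
        using * by (auto simp: min_def split: if_splits)
    qed
  qed
next
  fix x A B
  let ?c = "SUP b\<in>B. Scott_distance X d b A"
  show "Scott_distance X d x A \<le> Scott_distance X d x B + ?c"
    unfolding Scott_distance_def[of X d x A]
  proof (rule SUP_least, clarify)
    fix \<phi> assume \<phi>: "Scott_weight X d \<phi>" "\<forall>a\<in>A. \<phi> a = 0"
    show "\<phi> x \<le> Scott_distance X d x B + ?c"
    proof (cases "?c = top")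
      case False
      have "\<phi> b \<le> ?c" if "b \<in> B" for b
        using that \<phi> by (intro SUP_upper2[of b] Scott_distance_upper) auto
      then have "\<phi> b - ?c = 0" if "b \<in> B" for b
        using that False ennreal_minus_le_iff[of "\<phi> b" ?c 0] by simp
      then have "\<phi> x - ?c \<le> Scott_distance X d x B"
        by (intro Scott_distance_upper[of X d "\<lambda>z. \<phi> z - ?c"] Scott_weight_diff[OF \<phi>(1) False])
      then show ?thesis
        using False by (simp add: ennreal_minus_le_iff add.commute)
    next
      case True
      then show ?thesis by (simp only: add_top_right_ennreal top_greatest)
    qed
  qed
qed

end

theory Submission
  imports Defs
begin

text \<open>
  Scott weights are exactly the functions \<open>\<phi>\<close> with
  \<open>\<phi> x \<le> sup \<phi>(A) + \<sigma>(x, A)\<close>, that is, the contractions from the Scott approach space to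
  [0, \<open>\<infinity>\<close>].  Hence a map is a contraction of Scott approach spaces iff it pulls Scott weights
  back to Scott weights.  The distances \<open>d(-, y)\<close> are Scott weights, and pulling these back gives
  non-expansiveness and one half of the limit equation; the other half follows from
  non-expansiveness and the triangle inequality.
\<close>

lemma net_limsup_mono:
  assumes "\<And>j. j \<in> I \<Longrightarrow> g j \<le> h j"
  shows "net_limsup I r g \<le> net_limsup I r h"
  unfolding net_limsup_def using assms by (intro INF_superset_mono SUP_subset_mono) auto

lemma weight_dist_to:
  assumes "generalized_metric X d" "y \<in> X"
  shows "weight X d (\<lambda>z. d z y)"
  using assms unfolding generalized_metric_def weight_def by (simp add: add.commute)

text \<open>The limit condition holds with equality: it is the equation defining a Yoneda limit,
  read at the point \<open>y\<close>.\<close>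

lemma Scott_weight_dist_to:
  assumes "generalized_metric X d" "y \<in> X"
  shows "Scott_weight X d (\<lambda>z. d z y)"
  using assms weight_dist_to[OF assms] by (auto simp: Scott_weight_def Yoneda_limit_def)

text \<open>If the supremum \<open>c\<close> of \<open>\<phi>\<close> on \<open>A\<close> is finite,
  the truncated difference of \<open>\<phi>\<close> and \<open>c\<close> is again a Scott weight and
  vanishes on \<open>A\<close>, so it competes in the supremum defining the Scott distance.\<close>

lemma Scott_weight_le_Scott_distance:
  assumes "Scott_weight X d \<phi>"
  shows "\<phi> x \<le> (SUP a\<in>A. \<phi> a) + Scott_distance X d x A"
proof (cases "(SUP a\<in>A. \<phi> a) = top")
  case False
  let ?c = "SUP a\<in>A. \<phi> a"
  have "\<phi> a - ?c = 0" if "a \<in> A" for a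
    using that False ennreal_minus_le_iff[of "\<phi> a" ?c 0] by (simp add: SUP_upper)
  then have "\<phi> x - ?c \<le> Scott_distance X d x A"
    by (intro Scott_distance_upper[of X d "\<lambda>z. \<phi> z - ?c"] Scott_weight_diff assms False)
  then show ?thesis
    using False by (simp add: ennreal_minus_le_iff)
next
  case True
  then show ?thesis by (simp only: add_top_left_ennreal top_greatest)
qed

lemma Scott_distance_singleton_le:
  assumes "x \<in> X" "y \<in> X"
  shows "Scott_distance X d x {y} \<le> d x y"
  unfolding Scott_distance_def
proof (rule SUP_least, clarify)
  fix \<phi> assume \<phi>: "Scott_weight X d \<phi>" "\<forall>a\<in>{y}. \<phi> a = 0"
  then have "\<phi> x \<le> \<phi> y + d x y"
    using assms unfolding Scott_weight_def weight_def by blast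
  with \<phi>(2) show "\<phi> x \<le> d x y" by simp
qed

text \<open>A Scott weight that vanishes on a tail has upper limit 0 along the net, hence vanishes
  at the limit. In topological terms, a Yoneda limit lies in the closure of every tail.\<close>

lemma Scott_distance_tail:
  fixes X :: "'a set" and I :: "'a net_index set"
  assumes lim: "Yoneda_limit X d I r s x" and i: "i \<in> I"
  shows "Scott_distance X d x (s ` {j\<in>I. (i, j) \<in> r}) = 0"
proof -
  have "\<phi> x \<le> 0" if "Scott_weight X d \<phi>" "\<forall>a\<in>s ` {j\<in>I. (i, j) \<in> r}. \<phi> a = 0" for \<phi>
  proof -
    have "\<phi> x \<le> net_limsup I r (\<lambda>j. \<phi> (s j))"
      using that(1) lim unfolding Scott_weight_def by blast
    also have "\<dots> \<le> 0"
      unfolding net_limsup_def using that(2) i by (intro INF_lower2[of i] SUP_least) auto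
    finally show ?thesis .
  qed
  then have "Scott_distance X d x (s ` {j\<in>I. (i, j) \<in> r}) \<le> 0"
    unfolding Scott_distance_def by (intro SUP_least) blast
  then show ?thesis by simp
qed

text \<open>Converse of \<open>Scott_weight_le_Scott_distance\<close>. One-point sets
  \<open>A\<close> yield the weight inequality, and tails of a net yield the limit
  condition.\<close>

lemma Scott_weightI_Scott_distance:
  fixes X :: "'a set"
  assumes *: "\<And>x A. \<lbrakk>x \<in> X; A \<subseteq> X\<rbrakk> \<Longrightarrow> \<phi> x \<le> (SUP a\<in>A. \<phi> a) + Scott_distance X d x A"
  shows "Scott_weight X d \<phi>"
  unfolding Scott_weight_def
proof (intro conjI allI impI)
  show "weight X d \<phi>"
    unfolding weight_def
  proof (intro ballI)
    fix x y assume xy: "x \<in> X" "y \<in> X"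
    have "\<phi> x \<le> \<phi> y + Scott_distance X d x {y}" using *[of x "{y}"] xy by simp
    also have "\<dots> \<le> \<phi> y + d x y"
      by (intro add_left_mono Scott_distance_singleton_le xy)
    finally show "\<phi> x \<le> \<phi> y + d x y" .
  qed
next
  fix I :: "'a net_index set" and r s x
  assume lim: "Yoneda_limit X d I r s x"
  then have sX: "s \<in> I \<rightarrow> X" and xX: "x \<in> X"
    by (auto simp: Yoneda_limit_def forward_Cauchy_def)
  show "\<phi> x \<le> net_limsup I r (\<lambda>j. \<phi> (s j))"
    unfolding net_limsup_def
  proof (rule INF_greatest)
    fix i assume "i \<in> I"
    \<comment> \<open>With \<open>A\<close> the tail from \<open>i\<close>, the distance term is 0
      and only the supremum over the tail remains.\<close>
    then show "\<phi> x \<le> (SUP j\<in>{j\<in>I. (i, j) \<in> r}. \<phi> (s j))"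
      using *[OF xX, of "s ` {j\<in>I. (i, j) \<in> r}"] sX Scott_distance_tail[OF lim]
      by (auto simp: image_image)
  qed
qed

lemma Scott_weight_comp_Yoneda_continuous:
  fixes X :: "'a set" and Y :: "'b set"
  assumes gY: "generalized_metric Y dY" and f: "Yoneda_continuous X dX Y dY f"
    and \<phi>: "Scott_weight Y dY \<phi>"
  shows "Scott_weight X dX (\<lambda>z. \<phi> (f z))"
  unfolding Scott_weight_def
proof (intro conjI allI impI)
  show "weight X dX (\<lambda>z. \<phi> (f z))"
    unfolding weight_def
  proof (intro ballI)
    fix x y assume xy: "x \<in> X" "y \<in> X"
    then have "f x \<in> Y" "f y \<in> Y"
      using f by (auto simp: Yoneda_continuous_def non_expansive_def)
    then have "\<phi> (f x) \<le> \<phi> (f y) + dY (f x) (f y)"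
      using \<phi> unfolding Scott_weight_def weight_def by blast
    also have "\<dots> \<le> \<phi> (f y) + dX x y"
      using f xy by (intro add_left_mono) (auto simp: Yoneda_continuous_def non_expansive_def)
    finally show "\<phi> (f x) \<le> \<phi> (f y) + dX x y" .
  qed
next
  fix I :: "'a net_index set" and r s x
  assume "Yoneda_limit X dX I r s x"
  then have "Yoneda_limit Y dY I r (f \<circ> s) (f x)"
    using f by (simp add: Yoneda_continuous_def)
  \<comment> \<open>The image net is still indexed by sets over \<open>'a\<close>, whereas
    \<open>Scott_weight\<close> on \<open>Y\<close> speaks of index sets over \<open>'b\<close>; the
    transfer to arbitrary index types bridges this.\<close>
  from Scott_weight_any_index[OF gY \<phi> this]
  show "\<phi> (f x) \<le> net_limsup I r (\<lambda>j. \<phi> (f (s j)))" by simp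
qed

lemma Scott_weight_comp_contraction:
  assumes f: "approach_contraction X (Scott_distance X dX) Y (Scott_distance Y dY) f"
    and \<phi>: "Scott_weight Y dY \<phi>"
  shows "Scott_weight X dX (\<lambda>z. \<phi> (f z))"
proof (rule Scott_weightI_Scott_distance)
  fix x A assume xA: "x \<in> X" "A \<subseteq> X"
  have "\<phi> (f x) \<le> (SUP b\<in>f ` A. \<phi> b) + Scott_distance Y dY (f x) (f ` A)"
    by (rule Scott_weight_le_Scott_distance[OF \<phi>])
  also have "\<dots> = (SUP a\<in>A. \<phi> (f a)) + Scott_distance Y dY (f x) (f ` A)"
    by (simp add: image_image)
  also have "\<dots> \<le> (SUP a\<in>A. \<phi> (f a)) + Scott_distance X dX x A"
    using f xA by (intro add_left_mono) (auto simp: approach_contraction_def)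
  finally show "\<phi> (f x) \<le> (SUP a\<in>A. \<phi> (f a)) + Scott_distance X dX x A" .
qed

lemma approach_contraction_if_comp:
  assumes fXY: "f \<in> X \<rightarrow> Y"
    and comp: "\<And>\<phi>. Scott_weight Y dY \<phi> \<Longrightarrow> Scott_weight X dX (\<lambda>z. \<phi> (f z))"
  shows "approach_contraction X (Scott_distance X dX) Y (Scott_distance Y dY) f"
proof -
  have "Scott_distance Y dY (f x) (f ` A) \<le> Scott_distance X dX x A" for x A
    unfolding Scott_distance_def[of Y]
  proof (rule SUP_least, clarify)
    fix \<phi> assume "Scott_weight Y dY \<phi>" "\<forall>b\<in>f ` A. \<phi> b = 0"
    then show "\<phi> (f x) \<le> Scott_distance X dX x A"
      using Scott_distance_upper[OF comp, of \<phi> A x] by auto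
  qed
  with fXY show ?thesis
    by (simp add: approach_contraction_def approach_space_Scott_distance)
qed

lemma forward_Cauchy_comp:
  assumes ne: "non_expansive X dX Y dY f" and fC: "forward_Cauchy X dX I r s"
  shows "forward_Cauchy Y dY I r (f \<circ> s)"
proof (rule forward_CauchyI)
  show "directed_set I r" using fC by (simp add: forward_Cauchy_def)
  have sX: "s \<in> I \<rightarrow> X" using fC by (simp add: forward_Cauchy_def)
  then show "f \<circ> s \<in> I \<rightarrow> Y" using ne by (auto simp: non_expansive_def)
  fix e :: real assume "e > 0"
  then obtain i where i: "i \<in> I"
    "\<forall>j\<in>I. \<forall>k\<in>I. (i, j) \<in> r \<longrightarrow> (j, k) \<in> r \<longrightarrow> dX (s j) (s k) \<le> ennreal e"
    using forward_CauchyD[OF fC, of "ennreal e"] by auto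
  have le: "dY (f (s j)) (f (s k)) \<le> dX (s j) (s k)" if "j \<in> I" "k \<in> I" for j k
    using ne sX that by (auto simp: non_expansive_def)
  from i show "\<exists>i\<in>I. \<forall>j\<in>I. \<forall>k\<in>I. (i, j) \<in> r \<longrightarrow> (j, k) \<in> r \<longrightarrow>
      dY ((f \<circ> s) j) ((f \<circ> s) k) \<le> ennreal e"
    by (intro bexI[of _ i]) (auto intro: order_trans[OF le])
qed

lemma net_limsup_dist_comp_le:
  assumes gX: "generalized_metric X dX" and gY: "generalized_metric Y dY"
    and ne: "non_expansive X dX Y dY f" and lim: "Yoneda_limit X dX I r s x" and y: "y \<in> Y"
  shows "net_limsup I r (\<lambda>j. dY (f (s j)) y) \<le> dY (f x) y"
proof -
  \<comment> \<open>\<open>L\<close> is the limit equation at the limit point itself, where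
    \<open>dX x x = 0\<close>.\<close>
  have fC: "forward_Cauchy X dX I r s" and xX: "x \<in> X"
    and L: "net_limsup I r (\<lambda>j. dX (s j) x) = 0"
    using lim gX by (auto simp: Yoneda_limit_def generalized_metric_def)
  have dir: "directed_set I r" and sX: "s \<in> I \<rightarrow> X"
    using fC by (auto simp: forward_Cauchy_def)
  have fx: "f x \<in> Y" using ne xX by (auto simp: non_expansive_def)
  have "net_limsup I r (\<lambda>j. dY (f (s j)) y) \<le> net_limsup I r (\<lambda>j. dX (s j) x + dY (f x) y)"
  proof (rule net_limsup_mono)
    fix j assume j: "j \<in> I"
    then have "f (s j) \<in> Y" using ne sX by (auto simp: non_expansive_def)
    then have "dY (f (s j)) y \<le> dY (f (s j)) (f x) + dY (f x) y"
      using gY fx y by (simp add: generalized_metric_def)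
    also have "\<dots> \<le> dX (s j) x + dY (f x) y"
      using ne sX xX j by (intro add_right_mono) (auto simp: non_expansive_def)
    finally show "dY (f (s j)) y \<le> dX (s j) x + dY (f x) y" .
  qed
  \<comment> \<open>An upper limit is only subadditive in general; here the distances to
    \<open>x\<close> form a weight along a forward Cauchy net, so they converge and the constant can
    be split off exactly.\<close>
  also have "\<dots> = net_limsup I r (\<lambda>j. dX (s j) x) + dY (f x) y"
    by (intro net_limsup_eqI[OF dir] tendsto_add tendsto_const
        weight_tendsto_net_limsup[OF fC] weight_dist_to gX xX)
  finally show ?thesis by (simp add: L)
qed

lemma Yoneda_continuous_if_comp:
  fixes X :: "'a set" and Y :: "'b set"
  assumes gX: "generalized_metric X dX" and gY: "generalized_metric Y dY" and fXY: "f \<in> X \<rightarrow> Y"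
    and comp: "\<And>\<phi>. Scott_weight Y dY \<phi> \<Longrightarrow> Scott_weight X dX (\<lambda>z. \<phi> (f z))"
  shows "Yoneda_continuous X dX Y dY f"
  unfolding Yoneda_continuous_def
proof (intro conjI allI impI)
  have sw: "Scott_weight X dX (\<lambda>z. dY (f z) y)" if "y \<in> Y" for y
    by (intro comp[of "\<lambda>z. dY z y"] Scott_weight_dist_to gY that)
  have "dY (f x) (f y) \<le> dX x y" if xy: "x \<in> X" "y \<in> X" for x y
  proof -
    \<comment> \<open>This is the weight inequality for the pullback of the distance to
      \<open>f y\<close>.\<close>
    have "dY (f x) (f y) \<le> dY (f y) (f y) + dX x y"
      using sw[of "f y"] fXY xy by (auto simp: Scott_weight_def weight_def)
    also have "dY (f y) (f y) = 0" using gY fXY xy by (auto simp: generalized_metric_def)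
    finally show ?thesis by simp
  qed
  with fXY show ne: "non_expansive X dX Y dY f" by (simp add: non_expansive_def)
  fix I :: "'a net_index set" and r s x
  assume lim: "Yoneda_limit X dX I r s x"
  show "Yoneda_limit Y dY I r (f \<circ> s) (f x)"
    unfolding Yoneda_limit_def
  proof (intro conjI ballI)
    show "forward_Cauchy Y dY I r (f \<circ> s)"
      using lim by (intro forward_Cauchy_comp[OF ne]) (simp add: Yoneda_limit_def)
    show "f x \<in> Y" using lim fXY by (auto simp: Yoneda_limit_def)
    fix y assume y: "y \<in> Y"
    \<comment> \<open>The lower half of the limit equation is the Scott condition for the
      pulled-back distance to \<open>y\<close>.\<close>
    have "dY (f x) y \<le> net_limsup I r (\<lambda>j. dY (f (s j)) y)"
      using sw[OF y] lim by (simp add: Scott_weight_def)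
    with net_limsup_dist_comp_le[OF gX gY ne lim y]
    show "dY (f x) y = net_limsup I r (\<lambda>j. dY ((f \<circ> s) j) y)" by simp
  qed
qed

theorem theorem3p9:
  fixes X :: "'a set" and dX :: "'a \<Rightarrow> 'a \<Rightarrow> ennreal"
    and Y :: "'b set" and dY :: "'b \<Rightarrow> 'b \<Rightarrow> ennreal"
    and f :: "'a \<Rightarrow> 'b"
  assumes "generalized_metric X dX" and "generalized_metric Y dY"
    and "f \<in> X \<rightarrow> Y"
  shows "Yoneda_continuous X dX Y dY f \<longleftrightarrow>
    approach_contraction X (Scott_distance X dX) Y (Scott_distance Y dY) f"
proof
  assume "Yoneda_continuous X dX Y dY f"
  then show "approach_contraction X (Scott_distance X dX) Y (Scott_distance Y dY) f"
    by (rule approach_contraction_if_comp[OF assms(3) Scott_weight_comp_Yoneda_continuous[OF assms(2)]])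
next
  assume "approach_contraction X (Scott_distance X dX) Y (Scott_distance Y dY) f"
  then show "Yoneda_continuous X dX Y dY f"
    using Yoneda_continuous_if_comp[OF assms] Scott_weight_comp_contraction by blast
qed

end
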